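(* Let $n\ge 2$ and $N\ge 2$ be integers, let $h:[-1,1]\to[0,+\infty]$, and let $\{(\alpha_i,\rho_i)\}_{i=1}^{k}$ be a $1/N$-quadrature rule that is exact for a linear subspace $\Lambda\subset C([-1,1])$ and such that $$\mathcal{W}(n,N,\Lambda;h)=N^2\sum_{i=1}^{k}\rho_i h(\alpha_i).$$ Suppose $\Lambda'=\Lambda\bigoplus\mathrm{span}\{P_j^{(n)}: j\in I\}$ for some index set $I\subset\mathbb{N}=\{1,2,\ldots\}$. If $$Q_j^{(n)}:=\frac1N+\sum_{i=1}^{k}\rho_iP_j^{(n)}(\alpha_i)\ge0\quad\text{for all } j\in I,$$ then $$\mathcal{W}(n,N,\Lambda';h)=\mathcal{W}(n,N,\Lambda;h)=N^2\sum_{i=1}^{k}\rho_i h(\alpha_i).$$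
   Context: The Gegenbauer polynomials are $P_0^{(n)}=1$, $P_1^{(n)}=t$, $(i+n-2)P_{i+1}^{(n)}(t)=(2i+n-2)tP_i^{(n)}(t)-iP_{i-1}^{(n)}(t)$ for $i\ge1$; they are orthogonal on $[-1,1]$ with weight $(1-t^2)^{(n-3)/2}$ and $P_i^{(n)}(1)=1$. Put $\gamma_n:=\Gamma(n/2)/(\sqrt{\pi}\,\Gamma((n-1)/2))$ and, for $f\in C([-1,1])$, $f_0:=\gamma_n\int_{-1}^1 f(t)(1-t^2)^{(n-3)/2}\,dt$. $A_{n,h}$ is the set of functions $f:[-1,1]\to\mathbb{R}$ with $f(t)\le h(t)$ on $[-1,1]$ and $f(t)=\sum_{k=0}^\infty f_kP_k^{(n)}(t)$ with $f_k\ge0$ for all $k\ge1$ (so $f(1)=\sum_k f_k<\infty$ and the zeroth coefficient agrees with the $f_0$ above). For a subspace $\Lambda\subset C([-1,1])$, $\mathcal{W}(n,N,\Lambda;h):=\sup_{f\in\Lambda\cap A_{n,h}}N^2\left(f_0-f(1)/N\right)$. A $1/N$-quadrature rule is a finite sequence $\{(\alpha_i,\rho_i)\}_{i=1}^k$ with $-1\le\alpha_1<\alpha_2<\cdots<\alpha_k<1$ and $\rho_i>0$ for all $i$; it is exact for $\Lambda$ if $f_0=\frac{f(1)}{N}+\sum_{i=1}^k\rho_i f(\alpha_i)$ for all $f\in\Lambda$.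
   Formalization: The direct sum of Λ and span{P_j : j in I} is taken to be orthogonal for the inner product (fg)_0; with a merely algebraic direct sum the claim fails, e.g. N=3, Λ=span{1+t}, α=-1/3, ρ=1/2, h(-1/3)=2/3, h=+∞ elsewhere, I={1}. *)

theory Defs
  imports "HOL-Analysis.Analysis" "HOL-Library.Function_Algebras"
begin

text \<open>
  The pointwise real vector space structure on functions, so that the library notions
  \<open>subspace\<close> and \<open>span\<close> apply to sets of functions.
\<close>

instantiation "fun" :: (type, real_vector) real_vector
begin

definition scaleR_fun :: "real \<Rightarrow> ('a \<Rightarrow> 'b) \<Rightarrow> 'a \<Rightarrow> 'b" where
  "scaleR_fun c f = (\<lambda>x. c *\<^sub>R f x)"

instance
  by standard (simp_all add: scaleR_fun_def fun_eq_iff scaleR_add_right scaleR_add_left)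

end

text \<open>
  A function \<open>[-1,1] \<rightarrow> \<real>\<close> is represented by its extension by zero to the whole real line.
  This makes equality, addition and scaling of the representatives the same as for functions
  on \<open>[-1,1]\<close>.
\<close>

definition zero_outside :: "(real \<Rightarrow> real) \<Rightarrow> bool" where
  "zero_outside f \<longleftrightarrow> (\<forall>t. t \<notin> {-1..1} \<longrightarrow> f t = 0)"

definition C_interval :: "(real \<Rightarrow> real) set" where
  "C_interval = {f. zero_outside f \<and> continuous_on {-1..1} f}"

fun gegenbauer :: "nat \<Rightarrow> nat \<Rightarrow> real \<Rightarrow> real" where
  "gegenbauer n 0 t = 1"
| "gegenbauer n (Suc 0) t = t"
| "gegenbauer n (Suc (Suc i)) t =
     ((2 * real (Suc i) + real n - 2) * t * gegenbauer n (Suc i) t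
        - real (Suc i) * gegenbauer n i t)
     / (real (Suc i) + real n - 2)"

definition gegenbauer_fun :: "nat \<Rightarrow> nat \<Rightarrow> real \<Rightarrow> real" where
  "gegenbauer_fun n j = (\<lambda>t. if t \<in> {-1..1} then gegenbauer n j t else 0)"

text \<open>
  For \<open>n = 2\<close> the weight is singular at the end points, where \<open>powr\<close> takes the value 0;
  this does not affect the integrals.
\<close>

definition gegenbauer_weight :: "nat \<Rightarrow> real \<Rightarrow> real" where
  "gegenbauer_weight n t = (1 - t\<^sup>2) powr ((real n - 3) / 2)"

definition gamma_const :: "nat \<Rightarrow> real" where
  "gamma_const n = Gamma (real n / 2) / (sqrt pi * Gamma ((real n - 1) / 2))"

definition zeroth_coeff :: "nat \<Rightarrow> (real \<Rightarrow> real) \<Rightarrow> real" where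
  "zeroth_coeff n f = gamma_const n * integral {-1..1} (\<lambda>t. f t * gegenbauer_weight n t)"

definition A_set :: "nat \<Rightarrow> (real \<Rightarrow> ereal) \<Rightarrow> (real \<Rightarrow> real) set" where
  "A_set n h = {f. zero_outside f \<and> (\<forall>t\<in>{-1..1}. ereal (f t) \<le> h t) \<and>
     (\<exists>c :: nat \<Rightarrow> real. (\<forall>k\<ge>1. c k \<ge> 0) \<and>
        (\<forall>t\<in>{-1..1}. (\<lambda>k. c k * gegenbauer n k t) sums f t))}"

definition W_val :: "nat \<Rightarrow> nat \<Rightarrow> (real \<Rightarrow> real) set \<Rightarrow> (real \<Rightarrow> ereal) \<Rightarrow> ereal" where
  "W_val n N \<Lambda> h =
     (SUP f\<in>\<Lambda> \<inter> A_set n h. ereal ((real N)\<^sup>2 * (zeroth_coeff n f - f 1 / real N)))"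

text \<open>The nodes and weights are indexed by \<open>1, \<dots>, k\<close>; values at other indices are irrelevant.\<close>

definition quadrature_rule :: "nat \<Rightarrow> (nat \<Rightarrow> real) \<Rightarrow> (nat \<Rightarrow> real) \<Rightarrow> bool" where
  "quadrature_rule k \<alpha> \<rho> \<longleftrightarrow>
     strict_mono_on {1..k} \<alpha> \<and> (\<forall>i\<in>{1..k}. -1 \<le> \<alpha> i \<and> \<alpha> i < 1 \<and> \<rho> i > 0)"

definition exact_for ::
  "nat \<Rightarrow> nat \<Rightarrow> nat \<Rightarrow> (nat \<Rightarrow> real) \<Rightarrow> (nat \<Rightarrow> real) \<Rightarrow> (real \<Rightarrow> real) set \<Rightarrow> bool" where
  "exact_for n N k \<alpha> \<rho> \<Lambda> \<longleftrightarrow>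
     (\<forall>f\<in>\<Lambda>. zeroth_coeff n f = f 1 / real N + (\<Sum>i=1..k. \<rho> i * f (\<alpha> i)))"

definition Q_val :: "nat \<Rightarrow> nat \<Rightarrow> nat \<Rightarrow> (nat \<Rightarrow> real) \<Rightarrow> (nat \<Rightarrow> real) \<Rightarrow> nat \<Rightarrow> real" where
  "Q_val n N k \<alpha> \<rho> j = 1 / real N + (\<Sum>i=1..k. \<rho> i * gegenbauer n j (\<alpha> i))"

text \<open>
  The sum \<open>\<Lambda> \<oplus> M\<close> is read as the orthogonal direct sum with respect to the inner product
  \<open>\<langle>f, g\<rangle> = (f g)\<^sub>0\<close> under which the Gegenbauer polynomials are orthogonal. A direct sum that is
  merely algebraic does not suffice for optimality of a quadrature rule to pass from \<open>\<Lambda>\<close> to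
  the sum. Take \<open>n \<ge> 2\<close> arbitrary, \<open>N = 3\<close>, \<open>\<Lambda> = span {1 + t}\<close>, \<open>k = 1\<close>, \<open>\<alpha>\<^sub>1 = -1/3\<close>,
  \<open>\<rho>\<^sub>1 = 1/2\<close>, and let \<open>h\<close> be \<open>2/3\<close> at \<open>-1/3\<close> and infinite elsewhere. The rule is exact for
  \<open>\<Lambda>\<close>, the optimal value is 3 and equals \<open>N\<^sup>2 \<rho>\<^sub>1 h(\<alpha>\<^sub>1)\<close>, and \<open>Q\<^sub>1 = 1/6\<close>; but after adding
  \<open>P\<^sub>1 = t\<close> the constant function \<open>2/3\<close> becomes admissible, with value 4.
\<close>

definition orthogonal_direct_sum ::
  "nat \<Rightarrow> (real \<Rightarrow> real) set \<Rightarrow> (real \<Rightarrow> real) set \<Rightarrow> (real \<Rightarrow> real) set \<Rightarrow> bool" where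
  "orthogonal_direct_sum n \<Lambda> M S \<longleftrightarrow>
     S = {f + g | f g. f \<in> \<Lambda> \<and> g \<in> M} \<and>
     \<Lambda> \<inter> M = {0} \<and>
     (\<forall>f\<in>\<Lambda>. \<forall>g\<in>M. zeroth_coeff n (f * g) = 0)"

end

theory Submission
  imports Defs "HOL-Computational_Algebra.Polynomial"
begin

text \<open>
  Write \<open>P\<^sub>j\<close> for the Gegenbauer polynomials and \<open>w\<close> for their weight. Enlarging \<open>\<Lambda>\<close> can only
  increase the supremum, so only the upper bound is at stake. Let \<open>F\<close> be admissible for \<open>\<Lambda>'\<close>,
  and split it as \<open>F = f + (\<Sum>j\<in>J. b\<^sub>j P\<^sub>j)\<close> with \<open>f \<in> \<Lambda>\<close> and \<open>J \<subseteq> I\<close> finite. Every \<open>P\<^sub>j\<close> with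
  \<open>j \<ge> 1\<close> has mean zero, so \<open>F\<close> and \<open>f\<close> have the same zeroth coefficient. Exactness of the rule
  on \<open>f\<close>, rewritten in terms of \<open>F\<close>, then reads
  \<open>F\<^sub>0 = F(1)/N + (\<Sum>i. \<rho>\<^sub>i F(\<alpha>\<^sub>i)) - (\<Sum>j\<in>J. b\<^sub>j Q\<^sub>j)\<close>.
  If all \<open>b\<^sub>j\<close> are nonnegative, the last sum can be dropped and \<open>F \<le> h\<close> at the nodes finishes the
  proof (\<open>admissible_value_le\<close>).

  The sign of \<open>b\<^sub>j\<close> is where the orthogonality of the direct sum enters. Integrating \<open>F P\<^sub>j\<close> against
  \<open>w\<close> gives \<open>b\<^sub>j \<parallel>P\<^sub>j\<parallel>\<^sup>2\<close> by the splitting above, and \<open>c\<^sub>j \<parallel>P\<^sub>j\<parallel>\<^sup>2\<close> by the Gegenbauer expansion of \<open>F\<close>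
  (\<open>gegenbauer_coefficient\<close>), so \<open>b\<^sub>j = c\<^sub>j \<ge> 0\<close>.

  Integrating the expansion term by term requires orthogonality of the \<open>P\<^sub>j\<close> and the bound
  \<open>\<bar>P\<^sub>j\<bar> \<le> 1\<close> on \<open>[-1,1]\<close>, which makes the partial sums dominated by \<open>\<Sum>k. \<bar>c\<^sub>k\<bar>\<close>. Both are
  consequences of the Gegenbauer differential equation (\<open>gegenbauer_ode\<close>), which in turn follows
  from the recursion: orthogonality by integrating the derivative of the weighted Wronskian, and the
  bound from the monotonicity of Sonin's function.
\<close>

section \<open>Derivatives and the differential equation\<close>

text \<open>
  As formal polynomials the \<open>P\<^sub>k\<close> can be differentiated without side conditions, and a pointwise
  identity becomes an identity that can itself be differentiated.
\<close>

fun gegenbauer_poly :: "nat \<Rightarrow> nat \<Rightarrow> real poly" where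
  "gegenbauer_poly n 0 = 1"
| "gegenbauer_poly n (Suc 0) = [:0, 1:]"
| "gegenbauer_poly n (Suc (Suc i)) =
     smult (1 / (real (Suc i) + real n - 2))
       (smult (2 * real (Suc i) + real n - 2) ([:0, 1:] * gegenbauer_poly n (Suc i))
        - smult (real (Suc i)) (gegenbauer_poly n i))"

lemma poly_gegenbauer_poly: "poly (gegenbauer_poly n k) t = gegenbauer n k t"
  by (induction n k t rule: gegenbauer.induct) (simp_all add: mult.assoc)

lemma gegenbauer_1: "n \<ge> 2 \<Longrightarrow> gegenbauer n k 1 = 1"
proof (induction n k "1::real" rule: gegenbauer.induct)
  case (3 n i)
  have "real (Suc i) + real n - 2 > 0" using 3 by simp
  then show ?case using 3 by (simp add: field_simps)
qed simp_all

lemma abs_gegenbauer_minus: "\<bar>gegenbauer n k (- t)\<bar> = \<bar>gegenbauer n k t\<bar>"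
proof -
  have "gegenbauer n k (- t) = (- 1) ^ k * gegenbauer n k t"
    by (induction n k t rule: gegenbauer.induct) (simp_all add: field_simps)
  then show ?thesis by (simp add: abs_mult)
qed

definition gegenbauer_deriv :: "nat \<Rightarrow> nat \<Rightarrow> real \<Rightarrow> real" where
  "gegenbauer_deriv n k = poly (pderiv (gegenbauer_poly n k))"

definition gegenbauer_deriv2 :: "nat \<Rightarrow> nat \<Rightarrow> real \<Rightarrow> real" where
  "gegenbauer_deriv2 n k = poly (pderiv (pderiv (gegenbauer_poly n k)))"

lemma gegenbauer_rec:
  assumes "n \<ge> 2"
  shows "(real k + real n - 1) * gegenbauer n (Suc (Suc k)) t =
    (2 * real k + real n) * t * gegenbauer n (Suc k) t - (real k + 1) * gegenbauer n k t"
proof -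
  have "real k + real n - 1 > 0" using assms by simp
  then show ?thesis by (simp add: add.commute field_simps)
qed

lemma gegenbauer_deriv_rec:
  assumes "n \<ge> 2"
  shows "(real k + real n - 1) * gegenbauer_deriv n (Suc (Suc k)) t =
    (2 * real k + real n) * (gegenbauer n (Suc k) t + t * gegenbauer_deriv n (Suc k) t)
      - (real k + 1) * gegenbauer_deriv n k t"
proof -
  have "real k + real n - 1 > 0" using assms by simp
  then show ?thesis
    by (simp add: gegenbauer_deriv_def pderiv_smult pderiv_diff pderiv_mult pderiv_pCons
        poly_gegenbauer_poly add.commute field_simps)
qed

text \<open>
  The two first-order relations imply each other through the three-term recursion, but the
  induction step for the first one, obtained by differentiating the recursion, consumes both.
\<close>

lemma gegenbauer_structure:
  assumes n: "n \<ge> 2"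
  shows "(1 - t\<^sup>2) * gegenbauer_deriv n (Suc k) t
           = (real k + 1) * (gegenbauer n k t - t * gegenbauer n (Suc k) t)
       \<and> (1 - t\<^sup>2) * gegenbauer_deriv n k t
           = (real k + real n - 2) * (t * gegenbauer n k t - gegenbauer n (Suc k) t)"
proof (induction k)
  case 0
  show ?case by (simp add: gegenbauer_deriv_def pderiv_pCons power2_eq_square)
next
  case (Suc k)
  define A B C d where "A = gegenbauer n k t" and "B = gegenbauer n (Suc k) t"
    and "C = gegenbauer n (Suc (Suc k)) t" and "d = real k + real n - 1"
  have d: "d > 0" using n by (simp add: d_def)
  have r: "d * C = (real k + 1 + d) * t * B - (real k + 1) * A"
    using gegenbauer_rec[OF n, of k t] by (simp add: A_def B_def C_def d_def algebra_simps)
  have dr: "d * gegenbauer_deriv n (Suc (Suc k)) t =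
      (real k + 1 + d) * (B + t * gegenbauer_deriv n (Suc k) t) - (real k + 1) * gegenbauer_deriv n k t"
    using gegenbauer_deriv_rec[OF n, of k t] by (simp add: A_def B_def C_def d_def algebra_simps)
  have s1: "(1 - t\<^sup>2) * gegenbauer_deriv n (Suc k) t = (real k + 1) * (A - t * B)"
    and s2: "(1 - t\<^sup>2) * gegenbauer_deriv n k t = (d - 1) * (t * A - B)"
    using Suc by (simp_all add: A_def B_def d_def algebra_simps)
  \<comment> \<open>The first relation for \<open>k\<close> turns into the second one for \<open>Suc k\<close> by the recursion.\<close>
  have up: "(1 - t\<^sup>2) * gegenbauer_deriv n (Suc k) t = d * (t * B - C)"
    unfolding s1 using r by algebra
  have "d * ((1 - t\<^sup>2) * gegenbauer_deriv n (Suc (Suc k)) t) = d * ((real k + 2) * (B - t * C))"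
    using dr s1 s2 r by algebra
  then have "(1 - t\<^sup>2) * gegenbauer_deriv n (Suc (Suc k)) t = (real k + 2) * (B - t * C)"
    using d by simp
  then show ?case using up by (simp add: B_def C_def d_def algebra_simps)
qed

text \<open>
  Differentiating the first structure relation brings in the derivatives of \<open>P\<^sub>k\<close> and \<open>P\<^sub>k\<^sub>-\<^sub>1\<close>.
  After multiplication by \<open>1 - t\<^sup>2\<close> the structure relations eliminate both, which is why the
  equation is obtained where that factor can be cancelled again, on the open interval.
\<close>

lemma gegenbauer_ode:
  assumes n: "n \<ge> 2" and t: "t \<in> {-1<..<1}"
  shows "(1 - t\<^sup>2) * gegenbauer_deriv2 n k t
    = (real n - 1) * t * gegenbauer_deriv n k t - real k * (real k + real n - 2) * gegenbauer n k t"
proof (cases k)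
  case 0
  then show ?thesis by (simp add: gegenbauer_deriv_def gegenbauer_deriv2_def)
next
  case (Suc m)
  have t0: "1 - t\<^sup>2 \<noteq> 0"
  proof -
    have "\<bar>t\<bar> < 1" using t by auto
    then show ?thesis using abs_square_less_1[of t] by simp
  qed
  let ?G = "gegenbauer_poly n"
  have "[:1, 0, - 1:] * pderiv (?G (Suc m)) = smult (real m + 1) (?G m - [:0, 1:] * ?G (Suc m))"
  proof -
    have "poly ([:1, 0, - 1:] * pderiv (?G (Suc m))) =
        poly (smult (real m + 1) (?G m - [:0, 1:] * ?G (Suc m)))"
      using gegenbauer_structure[OF n, of _ m]
      by (auto simp: fun_eq_iff gegenbauer_deriv_def poly_gegenbauer_poly power2_eq_square algebra_simps)
    then show ?thesis by (simp only: poly_eq_poly_eq_iff)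
  qed
  then have "poly (pderiv ([:1, 0, - 1:] * pderiv (?G (Suc m)))) t =
      poly (pderiv (smult (real m + 1) (?G m - [:0, 1:] * ?G (Suc m)))) t"
    by simp
  then have "(1 - t\<^sup>2) * gegenbauer_deriv2 n (Suc m) t - 2 * t * gegenbauer_deriv n (Suc m) t
      = (real m + 1) * (gegenbauer_deriv n m t - gegenbauer n (Suc m) t - t * gegenbauer_deriv n (Suc m) t)"
    unfolding pderiv_mult pderiv_smult pderiv_diff
    by (simp add: pderiv_pCons gegenbauer_deriv_def gegenbauer_deriv2_def
        poly_gegenbauer_poly power2_eq_square algebra_simps)
  then have "(1 - t\<^sup>2) * ((1 - t\<^sup>2) * gegenbauer_deriv2 n (Suc m) t) =
      (1 - t\<^sup>2) * ((real n - 1) * t * gegenbauer_deriv n (Suc m) t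
        - (real m + 1) * (real m + real n - 1) * gegenbauer n (Suc m) t)"
    using gegenbauer_structure[OF n, of t m] by algebra
  then have "(1 - t\<^sup>2) * gegenbauer_deriv2 n (Suc m) t =
      (real n - 1) * t * gegenbauer_deriv n (Suc m) t
        - (real m + 1) * (real m + real n - 1) * gegenbauer n (Suc m) t"
    using t0 by (simp only: mult_left_cancel simp_thms)
  then show ?thesis using Suc by (simp add: algebra_simps)
qed

lemma has_real_derivative_gegenbauer:
  "(gegenbauer n k has_real_derivative gegenbauer_deriv n k t) (at t)"
  using poly_DERIV[of "gegenbauer_poly n k" t]
  by (simp add: gegenbauer_deriv_def poly_gegenbauer_poly[abs_def])

lemma has_real_derivative_gegenbauer_deriv:
  "(gegenbauer_deriv n k has_real_derivative gegenbauer_deriv2 n k t) (at t)"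
  unfolding gegenbauer_deriv_def gegenbauer_deriv2_def by (rule poly_DERIV)

lemma continuous_on_gegenbauer: "continuous_on S (gegenbauer n k)"
  by (meson DERIV_isCont continuous_at_imp_continuous_on has_real_derivative_gegenbauer)

lemma continuous_on_gegenbauer_deriv: "continuous_on S (gegenbauer_deriv n k)"
  by (meson DERIV_isCont continuous_at_imp_continuous_on has_real_derivative_gegenbauer_deriv)

lemma one_minus_square_pos: "t \<in> {-1<..<1} \<Longrightarrow> 0 < 1 - (t::real)\<^sup>2"
  using abs_square_less_1[of t] by auto

section \<open>The uniform bound\<close>

text \<open>
  With \<open>l = k (k + n - 2)\<close>, Sonin's function \<open>S = P\<^sub>k\<^sup>2 + (1 - t\<^sup>2) P\<^sub>k'\<^sup>2 / l\<close> dominates \<open>P\<^sub>k\<^sup>2\<close> and agrees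
  with it at 1. By the differential equation its derivative is \<open>2 (n - 2) t P\<^sub>k'\<^sup>2 / l\<close>, so \<open>S\<close> is
  increasing on \<open>[0,1]\<close> and \<open>P\<^sub>k\<^sup>2 \<le> S(1) = 1\<close> there. Negative arguments are covered by parity.
\<close>

lemma abs_gegenbauer_le_1:
  assumes n: "n \<ge> 2" and t: "t \<in> {-1..1}"
  shows "\<bar>gegenbauer n k t\<bar> \<le> 1"
proof (cases k)
  case 0
  then show ?thesis by simp
next
  case (Suc m)
  define l where "l = real k * (real k + real n - 2)"
  have l: "l > 0" using n Suc by (simp add: l_def)
  then have l0: "l \<noteq> 0" by simp
  define S where "S t = (gegenbauer n k t)\<^sup>2 + (1 - t\<^sup>2) * (gegenbauer_deriv n k t)\<^sup>2 / l" for t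
  have "\<bar>gegenbauer n k s\<bar> \<le> 1" if s: "0 \<le> s" "s \<le> 1" for s
  proof -
    have der: "(S has_real_derivative 2 * (real n - 2) * x * (gegenbauer_deriv n k x)\<^sup>2 / l) (at x)"
      if x: "x \<in> {-1<..<1}" for x
    proof -
      define p q r where "p = gegenbauer n k x" and "q = gegenbauer_deriv n k x"
        and "r = gegenbauer_deriv2 n k x"
      have "(S has_real_derivative
         2 * p * q + (- 2 * x * q\<^sup>2 + (1 - x\<^sup>2) * (2 * q * r)) / l) (at x)"
        unfolding S_def
        by (rule derivative_eq_intros has_real_derivative_gegenbauer
            has_real_derivative_gegenbauer_deriv refl l0)+
          (use l in \<open>simp add: p_def q_def r_def power2_eq_square field_simps\<close>)
      moreover have "2 * p * q + (- 2 * x * q\<^sup>2 + (1 - x\<^sup>2) * (2 * q * r)) / l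
          = 2 * q * (l * p - x * q + (1 - x\<^sup>2) * r) / l"
        using l0 by (simp add: field_simps power2_eq_square)
      moreover have "l * p - x * q + (1 - x\<^sup>2) * r = (real n - 2) * x * q"
        using gegenbauer_ode[OF n x, of k]
        by (simp add: p_def q_def r_def l_def algebra_simps)
      ultimately have "(S has_real_derivative 2 * q * ((real n - 2) * x * q) / l) (at x)"
        by simp
      then show ?thesis
        by (rule DERIV_cong) (simp add: q_def power2_eq_square algebra_simps)
    qed
    have "S s \<le> S 1"
    proof (rule DERIV_nonneg_imp_increasing_open[OF s(2)])
      fix x assume x: "s < x" "x < 1"
      have "2 * (real n - 2) * x * (gegenbauer_deriv n k x)\<^sup>2 / l \<ge> 0"
        using n x s l by (intro divide_nonneg_pos mult_nonneg_nonneg) auto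
      then show "\<exists>y. DERIV S x :> y \<and> 0 \<le> y" using der[of x] x s by auto
    next
      show "continuous_on {s..1} S"
        unfolding S_def
        by (intro continuous_intros continuous_on_gegenbauer continuous_on_gegenbauer_deriv)
          (use l in auto)
    qed
    moreover have "(gegenbauer n k s)\<^sup>2 \<le> S s"
      using l abs_square_le_1[of s] s by (simp add: S_def)
    moreover have "S 1 = 1" using gegenbauer_1[OF n] by (simp add: S_def)
    ultimately show ?thesis by (simp add: abs_square_le_1[symmetric])
  qed
  then have "\<bar>gegenbauer n k \<bar>t\<bar>\<bar> \<le> 1" using t by auto
  then show ?thesis
    using abs_gegenbauer_minus[of n k t] by (cases "t \<ge> 0") auto
qed

section \<open>Integrability of the weight\<close>

lemma gegenbauer_weight_nonneg: "gegenbauer_weight n t \<ge> 0"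
  by (simp add: gegenbauer_weight_def)

lemma gegenbauer_weight_measurable: "gegenbauer_weight n \<in> borel_measurable (lebesgue_on {-1..1})"
proof -
  have "gegenbauer_weight n \<in> borel_measurable borel"
    unfolding gegenbauer_weight_def by measurable
  then show ?thesis
    by (intro measurable_restrict_space1 measurable_completion) simp
qed

text \<open>
  The weight decreases in \<open>n\<close>, so the case \<open>n = 2\<close> dominates all others, and there the weight is the
  derivative of \<open>arcsin\<close>, which is continuous up to the end points.
\<close>

lemma gegenbauer_weight_integrable:
  assumes n: "n \<ge> 2"
  shows "gegenbauer_weight n integrable_on {-1..1}"
proof (rule measurable_bounded_by_integrable_imp_integrable[OF gegenbauer_weight_measurable])
  have "(gegenbauer_weight 2 has_integral (arcsin 1 - arcsin (-1))) {-1..1}"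
  proof (rule fundamental_theorem_of_calculus_interior)
    show "continuous_on {-1..1} arcsin" by (rule continuous_on_arcsin')
  next
    fix x :: real assume x: "x \<in> {-1<..<1}"
    have "inverse (sqrt (1 - x\<^sup>2)) = gegenbauer_weight 2 x"
      using one_minus_square_pos[OF x]
      by (simp add: gegenbauer_weight_def powr_minus powr_half_sqrt)
    then show "(arcsin has_vector_derivative gegenbauer_weight 2 x) (at x)"
      using DERIV_arcsin[of x] x by (simp add: has_real_derivative_iff_has_vector_derivative)
  qed simp
  then show "gegenbauer_weight 2 integrable_on {-1..1}" by blast
next
  fix x :: real assume x: "x \<in> {-1..1}"
  have "0 \<le> 1 - x\<^sup>2" "1 - x\<^sup>2 \<le> 1" using x abs_square_le_1[of x] by auto
  then show "norm (gegenbauer_weight n x) \<le> gegenbauer_weight 2 x"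
    using n by (simp add: gegenbauer_weight_def powr_mono')
qed simp

lemma continuous_times_weight_integrable:
  assumes n: "n \<ge> 2" and f: "continuous_on {-1..1} f"
  shows "(\<lambda>t. f t * gegenbauer_weight n t) integrable_on {-1..1}"
proof -
  have "bounded (f ` {-1..1})"
    using compact_continuous_image[OF f] compact_imp_bounded by blast
  then obtain B where B: "\<And>t. t \<in> {-1..1} \<Longrightarrow> norm (f t) \<le> B"
    unfolding bounded_iff by blast
  show ?thesis
  proof (rule measurable_bounded_by_integrable_imp_integrable)
    show "(\<lambda>t. f t * gegenbauer_weight n t) \<in> borel_measurable (lebesgue_on {-1..1})"
      by (intro borel_measurable_times gegenbauer_weight_measurable
          continuous_imp_measurable_on_sets_lebesgue[OF f]) simp
    show "(\<lambda>t. B * gegenbauer_weight n t) integrable_on {-1..1}"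
      using gegenbauer_weight_integrable[OF n] by (rule integrable_on_mult_right)
    show "norm (f t * gegenbauer_weight n t) \<le> B * gegenbauer_weight n t" if "t \<in> {-1..1}" for t
      using B[OF that] gegenbauer_weight_nonneg[of n t]
      by (simp add: abs_mult mult_right_mono)
  qed simp
qed

section \<open>Orthogonality\<close>

text \<open>
  The weighted Wronskian \<open>V = (1 - t\<^sup>2) w (P\<^sub>i' P\<^sub>j - P\<^sub>i P\<^sub>j')\<close> vanishes at both end points, and the
  differential equation gives \<open>V' = (l\<^sub>j - l\<^sub>i) P\<^sub>i P\<^sub>j w\<close> with distinct eigenvalues
  \<open>l\<^sub>k = k (k + n - 2)\<close>.
\<close>

lemma gegenbauer_orthogonal:
  assumes n: "n \<ge> 2" and ij: "i \<noteq> j"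
  shows "integral {-1..1} (\<lambda>t. gegenbauer n i t * gegenbauer n j t * gegenbauer_weight n t) = 0"
proof -
  define l where "l k = real k * (real k + real n - 2)" for k
  define X where "X t = gegenbauer_deriv n i t * gegenbauer n j t
      - gegenbauer n i t * gegenbauer_deriv n j t" for t
  define X' where "X' t = gegenbauer_deriv2 n i t * gegenbauer n j t
      - gegenbauer n i t * gegenbauer_deriv2 n j t" for t
  define V where "V t = (1 - t\<^sup>2) powr ((real n - 1) / 2) * X t" for t
  have "((\<lambda>t. (l j - l i) * (gegenbauer n i t * gegenbauer n j t * gegenbauer_weight n t))
      has_integral V 1 - V (-1)) {-1..1}"
  proof (rule fundamental_theorem_of_calculus_interior)
    show "continuous_on {-1..1} V"
      unfolding V_def X_def using n
      by (intro continuous_intros continuous_on_powr' continuous_on_gegenbauer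
          continuous_on_gegenbauer_deriv) (auto simp: abs_square_le_1)
  next
    fix x :: real assume x: "x \<in> {-1<..<1}"
    define w where "w = gegenbauer_weight n x"
    have pos: "0 < 1 - x\<^sup>2" using x by (rule one_minus_square_pos)
    have dX: "(X has_real_derivative X' x) (at x)"
      unfolding X_def X'_def
      by (rule derivative_eq_intros has_real_derivative_gegenbauer
            has_real_derivative_gegenbauer_deriv refl)+ (simp add: algebra_simps)
    have dw: "((\<lambda>t. (1 - t\<^sup>2) powr ((real n - 1) / 2)) has_real_derivative
        - (real n - 1) * x * w) (at x)"
    proof -
      have "(real n - 1) / 2 - 1 = (real n - 3) / 2" by (simp add: field_simps)
      then show ?thesis
        unfolding w_def gegenbauer_weight_def using pos
        by (auto intro!: derivative_eq_intros simp: field_simps powr_diff)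
    qed
    have pw: "(1 - x\<^sup>2) powr ((real n - 1) / 2) = (1 - x\<^sup>2) * w"
    proof -
      have "(1 - x\<^sup>2) powr ((real n - 1) / 2) = (1 - x\<^sup>2) powr (1 + (real n - 3) / 2)"
        by (simp add: field_simps)
      then show ?thesis using pos by (simp add: powr_add w_def gegenbauer_weight_def)
    qed
    have "(V has_real_derivative
        - (real n - 1) * x * w * X x + X' x * ((1 - x\<^sup>2) powr ((real n - 1) / 2))) (at x)"
      unfolding V_def by (rule DERIV_mult'[OF dw dX, THEN DERIV_cong]) simp
    moreover have "- (real n - 1) * x * w * X x + X' x * ((1 - x\<^sup>2) * w)
      = (l j - l i) * (gegenbauer n i x * gegenbauer n j x * w)"
      using gegenbauer_ode[OF n x, of i] gegenbauer_ode[OF n x, of j]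
      unfolding X_def X'_def l_def by algebra
    ultimately show "(V has_vector_derivative
        (l j - l i) * (gegenbauer n i x * gegenbauer n j x * gegenbauer_weight n x)) (at x)"
      unfolding pw w_def by (simp add: has_real_derivative_iff_has_vector_derivative)
  qed simp
  then have "(l j - l i) * integral {-1..1}
      (\<lambda>t. gegenbauer n i t * gegenbauer n j t * gegenbauer_weight n t) = 0"
    by (auto simp: V_def dest: integral_unique)
  moreover have "l j - l i \<noteq> 0"
  proof -
    have "l j - l i = (real j - real i) * (real i + real j + real n - 2)"
      by (simp add: l_def algebra_simps)
    then show ?thesis using ij n by auto
  qed
  ultimately show ?thesis by simp
qed

text \<open>
  If the norm vanished, \<open>P\<^sub>k\<close> would have infinitely many zeros. The argument is run on
  \<open>[-1/2,1/2]\<close>, where the weight is continuous and positive.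
\<close>

lemma gegenbauer_norm_pos:
  assumes n: "n \<ge> 2"
  shows "integral {-1..1} (\<lambda>t. gegenbauer n k t * gegenbauer n k t * gegenbauer_weight n t) > 0"
proof (rule ccontr)
  let ?f = "\<lambda>t. gegenbauer n k t * gegenbauer n k t * gegenbauer_weight n t"
  assume "\<not> integral {-1..1} ?f > 0"
  moreover have int: "?f integrable_on {-1..1}"
    by (rule continuous_times_weight_integrable[OF n])
      (intro continuous_intros continuous_on_gegenbauer)
  moreover have nn: "?f t \<ge> 0" for t
    using gegenbauer_weight_nonneg by simp
  moreover have int': "?f integrable_on {-1/2..1/2}"
    by (rule integrable_on_subinterval[OF int]) auto
  moreover have "integral {-1/2..1/2} ?f \<le> integral {-1..1} ?f"
    using int int' nn by (intro integral_subset_le) auto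
  moreover have "integral {-1/2..1/2} ?f \<ge> 0"
    using int' nn by (intro integral_nonneg) auto
  ultimately have "integral {-1/2..1/2} ?f = 0" by linarith
  then have z: "(?f has_integral 0) {-1/2..1/2}" using int' by (metis integrable_integral)
  have pos: "0 < 1 - t\<^sup>2" if "t \<in> {-1/2..1/2}" for t :: real
    using that by (intro one_minus_square_pos) auto
  have "?f t = 0" if t: "t \<in> {-1/2..1/2}" for t
  proof (rule has_integral_0_cbox_imp_0[where f = ?f and a = "-1/2" and b = "1/2"])
    show "continuous_on (cbox (- 1 / 2) (1 / 2)) ?f"
      unfolding gegenbauer_weight_def using pos
      by (intro continuous_intros continuous_on_powr' continuous_on_gegenbauer)
        (auto simp: less_imp_le, force)
  qed (use nn z t in auto)
  then have "gegenbauer n k t = 0" if "t \<in> {-1/2..1/2}" for t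
    using that pos[OF that] by (force simp: gegenbauer_weight_def)
  then have "{-1/2..1/2} \<subseteq> {t. poly (gegenbauer_poly n k) t = 0}"
    by (auto simp: poly_gegenbauer_poly)
  moreover have "infinite {-1/2..1/2::real}" by (simp add: infinite_Icc)
  ultimately have "gegenbauer_poly n k = 0"
    using poly_roots_finite finite_subset by blast
  then show False
    using gegenbauer_1[OF n, of k] poly_gegenbauer_poly[of n k 1] by simp
qed

section \<open>Coefficients of Gegenbauer expansions\<close>

text \<open>
  Evaluating the expansion at 1, where all \<open>P\<^sub>k\<close> equal 1, shows that \<open>\<Sum>k. c\<^sub>k\<close> converges, and the
  sign condition turns this into absolute convergence. As \<open>\<bar>P\<^sub>k\<bar> \<le> 1\<close>, the weight times a constant
  then dominates the partial sums, and orthogonality leaves a single term.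
\<close>

lemma gegenbauer_coefficient:
  assumes n: "n \<ge> 2" and c: "\<And>k. k \<ge> 1 \<Longrightarrow> c k \<ge> 0"
    and f: "\<And>t. t \<in> {-1..1} \<Longrightarrow> (\<lambda>k. c k * gegenbauer n k t) sums f t"
  shows "integral {-1..1} (\<lambda>t. f t * gegenbauer n j t * gegenbauer_weight n t)
    = c j * integral {-1..1} (\<lambda>t. gegenbauer n j t * gegenbauer n j t * gegenbauer_weight n t)"
proof -
  let ?P = "gegenbauer n" and ?w = "gegenbauer_weight n"
  define s where "s m t = (\<Sum>k<m. c k * ?P k t)" for m t
  have "summable c"
    using f[of 1] gegenbauer_1[OF n] by (simp add: sums_iff)
  then have "summable (\<lambda>k. \<bar>c k\<bar>)"
    using summable_cong[of c "\<lambda>k. \<bar>c k\<bar>"] c eventually_sequentiallyI[of 1 "\<lambda>k. c k = \<bar>c k\<bar>"]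
    by fastforce
  then have s_le: "\<bar>s m t\<bar> \<le> (\<Sum>k. \<bar>c k\<bar>)" if "t \<in> {-1..1}" for m t
  proof -
    have "\<bar>s m t\<bar> \<le> (\<Sum>k<m. \<bar>c k * ?P k t\<bar>)" unfolding s_def by (rule sum_abs)
    also have "\<dots> \<le> (\<Sum>k<m. \<bar>c k\<bar>)"
      using abs_gegenbauer_le_1[OF n that] by (intro sum_mono) (simp add: abs_mult mult_left_le)
    also have "\<dots> \<le> (\<Sum>k. \<bar>c k\<bar>)"
      by (intro sum_le_suminf \<open>summable (\<lambda>k. \<bar>c k\<bar>)\<close>) auto
    finally show ?thesis .
  qed
  have int: "(\<lambda>t. ?P i t * ?P j t * ?w t) integrable_on {-1..1}" for i
    by (rule continuous_times_weight_integrable[OF n])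
      (intro continuous_intros continuous_on_gegenbauer)
  have s_int: "integral {-1..1} (\<lambda>t. s m t * ?P j t * ?w t)
      = (if j < m then c j * integral {-1..1} (\<lambda>t. ?P j t * ?P j t * ?w t) else 0)" for m
  proof -
    have "(\<lambda>t. s m t * ?P j t * ?w t) = (\<lambda>t. \<Sum>k<m. c k * (?P k t * ?P j t * ?w t))"
      by (simp add: s_def sum_distrib_right mult.assoc fun_eq_iff)
    then have "integral {-1..1} (\<lambda>t. s m t * ?P j t * ?w t)
        = (\<Sum>k<m. c k * integral {-1..1} (\<lambda>t. ?P k t * ?P j t * ?w t))"
      using int by (simp add: integral_sum integrable_on_mult_right)
    also have "\<dots> = (\<Sum>k<m. if k = j
        then c j * integral {-1..1} (\<lambda>t. ?P j t * ?P j t * ?w t) else 0)"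
      using gegenbauer_orthogonal[OF n] by (intro sum.cong) auto
    finally show ?thesis by simp
  qed
  have "(\<lambda>m. integral {-1..1} (\<lambda>t. s m t * ?P j t * ?w t))
      \<longlonglongrightarrow> integral {-1..1} (\<lambda>t. f t * ?P j t * ?w t)"
  proof (rule dominated_convergence)
    show "(\<lambda>t. s m t * ?P j t * ?w t) integrable_on {-1..1}" for m
      unfolding s_def by (rule continuous_times_weight_integrable[OF n])
        (intro continuous_intros continuous_on_gegenbauer)
    show "(\<lambda>t. (\<Sum>k. \<bar>c k\<bar>) * ?w t) integrable_on {-1..1}"
      using gegenbauer_weight_integrable[OF n] by (rule integrable_on_mult_right)
    show "norm (s m t * ?P j t * ?w t) \<le> (\<Sum>k. \<bar>c k\<bar>) * ?w t" if t: "t \<in> {-1..1}" for m t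
    proof -
      have "\<bar>s m t\<bar> * \<bar>?P j t\<bar> \<le> (\<Sum>k. \<bar>c k\<bar>) * 1"
        using s_le[OF t] abs_gegenbauer_le_1[OF n t] order_trans[OF abs_ge_zero s_le[OF t]]
        by (intro mult_mono) auto
      then show ?thesis
        using gegenbauer_weight_nonneg[of n t] by (simp add: abs_mult mult_right_mono)
    qed
    show "(\<lambda>m. s m t * ?P j t * ?w t) \<longlonglongrightarrow> f t * ?P j t * ?w t" if "t \<in> {-1..1}" for t
      using f[OF that] by (intro tendsto_intros) (simp add: s_def sums_def)
  qed
  moreover have "(\<lambda>m. integral {-1..1} (\<lambda>t. s m t * ?P j t * ?w t))
      \<longlonglongrightarrow> c j * integral {-1..1} (\<lambda>t. ?P j t * ?P j t * ?w t)"
    unfolding s_int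
    by (intro tendsto_eventually eventually_sequentiallyI[of "Suc j"]) simp
  ultimately show ?thesis by (rule LIMSEQ_unique)
qed

lemma gamma_const_pos: "n \<ge> 2 \<Longrightarrow> gamma_const n > 0"
  by (simp add: gamma_const_def Gamma_real_pos)

lemma sum_fun_apply: "(\<Sum>a\<in>A. F a) x = (\<Sum>a\<in>A. F a x)" for F :: "'a \<Rightarrow> 'b \<Rightarrow> 'c::comm_monoid_add"
  by (induction A rule: infinite_finite_induct) auto

lemma span_gegenbauer_funE:
  assumes "g \<in> span (gegenbauer_fun n ` I)"
  obtains J b where "finite J" "J \<subseteq> I"
    "\<And>t. t \<in> {-1..1} \<Longrightarrow> g t = (\<Sum>j\<in>J. b j * gegenbauer n j t)"
proof -
  obtain T r where T: "finite T" "T \<subseteq> gegenbauer_fun n ` I" and g: "g = (\<Sum>v\<in>T. r v *\<^sub>R v)"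
    using assms unfolding span_explicit by blast
  obtain J where J: "J \<subseteq> I" "inj_on (gegenbauer_fun n) J" "T = gegenbauer_fun n ` J"
    using T(2) unfolding subset_image_inj by blast
  have g_eq: "g t = (\<Sum>j\<in>J. r (gegenbauer_fun n j) * gegenbauer n j t)" if "t \<in> {-1..1}" for t
  proof -
    have "g t = (\<Sum>j\<in>J. (r (gegenbauer_fun n j) *\<^sub>R gegenbauer_fun n j) t)"
      unfolding g J(3) by (simp add: sum.reindex[OF J(2)] sum_fun_apply)
    then show ?thesis using that by (simp add: scaleR_fun_def gegenbauer_fun_def)
  qed
  have "finite J" using T(1) J by (simp add: finite_image_iff)
  then show thesis using J(1) g_eq by (rule that)
qed

text \<open>
  Used with \<open>i \<in> J\<close> to read off the coefficients of the polynomial part, and with \<open>i = 0\<close>, where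
  \<open>P\<^sub>0 = 1\<close>, to see that a polynomial part without \<open>P\<^sub>0\<close> component leaves the zeroth coefficient
  unchanged.
\<close>

lemma integral_gegenbauer_add_sum:
  assumes n: "n \<ge> 2" and f: "continuous_on {-1..1} f" and J: "finite J"
    and F: "\<And>t. t \<in> {-1..1} \<Longrightarrow> F t = f t + (\<Sum>j\<in>J. b j * gegenbauer n j t)"
  shows "integral {-1..1} (\<lambda>t. F t * gegenbauer n i t * gegenbauer_weight n t)
    = integral {-1..1} (\<lambda>t. f t * gegenbauer n i t * gegenbauer_weight n t)
      + (if i \<in> J then b i * integral {-1..1}
          (\<lambda>t. gegenbauer n i t * gegenbauer n i t * gegenbauer_weight n t) else 0)"
proof -
  let ?P = "gegenbauer n" and ?w = "gegenbauer_weight n"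
  have int: "(\<lambda>t. ?P j t * ?P i t * ?w t) integrable_on {-1..1}" for j
    by (rule continuous_times_weight_integrable[OF n])
      (intro continuous_intros continuous_on_gegenbauer)
  have intf: "(\<lambda>t. f t * ?P i t * ?w t) integrable_on {-1..1}"
    by (rule continuous_times_weight_integrable[OF n])
      (intro continuous_intros continuous_on_gegenbauer f)
  have "integral {-1..1} (\<lambda>t. F t * ?P i t * ?w t)
      = integral {-1..1} (\<lambda>t. f t * ?P i t * ?w t + (\<Sum>j\<in>J. b j * (?P j t * ?P i t * ?w t)))"
    by (rule integral_cong) (simp add: F distrib_right sum_distrib_right mult.assoc)
  also have "\<dots> = integral {-1..1} (\<lambda>t. f t * ?P i t * ?w t)
      + (\<Sum>j\<in>J. b j * integral {-1..1} (\<lambda>t. ?P j t * ?P i t * ?w t))"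
    using int intf J
    by (simp add: integral_add integral_sum integrable_sum integrable_on_mult_right)
  also have "(\<Sum>j\<in>J. b j * integral {-1..1} (\<lambda>t. ?P j t * ?P i t * ?w t))
      = (\<Sum>j\<in>J. if i = j then b i * integral {-1..1} (\<lambda>t. ?P i t * ?P i t * ?w t) else 0)"
    using gegenbauer_orthogonal[OF n] by (intro sum.cong) auto
  finally show ?thesis using J by simp
qed

section \<open>Passing to the larger space\<close>

text \<open>
  The defect of the rule on \<open>F\<close> is \<open>\<Sum>j\<in>J. b\<^sub>j Q\<^sub>j\<close>, where the \<open>b\<^sub>j\<close> are the coefficients of the
  component of \<open>F\<close> in the added span. As that component is orthogonal to the one in \<open>\<Lambda>\<close>, the \<open>b\<^sub>j\<close>
  are Gegenbauer coefficients of \<open>F\<close>, hence nonnegative.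
\<close>

lemma admissible_value_le:
  assumes n: "n \<ge> 2"
    and \<Lambda>: "\<Lambda> \<subseteq> C_interval" and rule: "quadrature_rule k \<alpha> \<rho>"
    and exact: "exact_for n N k \<alpha> \<rho> \<Lambda>" and I: "I \<subseteq> {1..}"
    and sum: "orthogonal_direct_sum n \<Lambda> (span (gegenbauer_fun n ` I)) \<Lambda>'"
    and Q: "\<And>j. j \<in> I \<Longrightarrow> Q_val n N k \<alpha> \<rho> j \<ge> 0"
    and F: "F \<in> \<Lambda>'" "F \<in> A_set n h"
  shows "zeroth_coeff n F - F 1 / real N \<le> (\<Sum>i=1..k. \<rho> i * F (\<alpha> i))"
proof -
  let ?P = "gegenbauer n" and ?w = "gegenbauer_weight n"
  obtain f g where f: "f \<in> \<Lambda>" and g: "g \<in> span (gegenbauer_fun n ` I)" and Ffg: "F = f + g"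
    using sum F(1) unfolding orthogonal_direct_sum_def by blast
  obtain J b where J: "finite J" "J \<subseteq> I"
    and b: "\<And>t. t \<in> {-1..1} \<Longrightarrow> g t = (\<Sum>j\<in>J. b j * ?P j t)"
    using span_gegenbauer_funE[OF g] by blast
  have F_eq: "F t = f t + (\<Sum>j\<in>J. b j * ?P j t)" if "t \<in> {-1..1}" for t
    using b[OF that] by (simp add: Ffg)
  have cont: "continuous_on {-1..1} f" using f \<Lambda> by (auto simp: C_interval_def)
  obtain c where c: "\<And>k. k \<ge> 1 \<Longrightarrow> c k \<ge> 0"
    and cF: "\<And>t. t \<in> {-1..1} \<Longrightarrow> (\<lambda>k. c k * ?P k t) sums F t"
    using F(2) unfolding A_set_def by blast
  note expand = integral_gegenbauer_add_sum[where F = F and J = J, OF n cont J(1) F_eq]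
  have b_nonneg: "b j \<ge> 0" if j: "j \<in> J" for j
  proof -
    let ?norm = "integral {-1..1} (\<lambda>t. ?P j t * ?P j t * ?w t)"
    have "gegenbauer_fun n j \<in> span (gegenbauer_fun n ` I)"
      using j J(2) by (intro span_base) auto
    then have "zeroth_coeff n (f * gegenbauer_fun n j) = 0"
      using sum f unfolding orthogonal_direct_sum_def by blast
    moreover have "integral {-1..1} (\<lambda>t. (f * gegenbauer_fun n j) t * ?w t)
        = integral {-1..1} (\<lambda>t. f t * ?P j t * ?w t)"
      by (rule integral_cong) (simp add: gegenbauer_fun_def)
    ultimately have "integral {-1..1} (\<lambda>t. f t * ?P j t * ?w t) = 0"
      using gamma_const_pos[OF n] by (simp add: zeroth_coeff_def)
    then have "c j * ?norm = b j * ?norm"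
      using expand[of j] gegenbauer_coefficient[OF n c cF, of j] j by auto
    then have "b j = c j" using gegenbauer_norm_pos[OF n, of j] by auto
    then show ?thesis using c[of j] j J(2) I by auto
  qed
  have "zeroth_coeff n F = zeroth_coeff n f"
  proof -
    \<comment> \<open>The indices in \<open>I\<close> start at 1, so the polynomial part has mean zero.\<close>
    have "0 \<notin> J" using J(2) I by auto
    then show ?thesis using expand[of 0] by (simp add: zeroth_coeff_def)
  qed
  also have "\<dots> = f 1 / real N + (\<Sum>i=1..k. \<rho> i * f (\<alpha> i))"
    using exact f by (simp add: exact_for_def)
  finally have "zeroth_coeff n F = f 1 / real N + (\<Sum>i=1..k. \<rho> i * f (\<alpha> i))" .
  moreover have "F 1 = f 1 + (\<Sum>j\<in>J. b j)"
    using F_eq[of 1] gegenbauer_1[OF n] by simp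
  moreover have "(\<Sum>i=1..k. \<rho> i * F (\<alpha> i)) =
      (\<Sum>i=1..k. \<rho> i * f (\<alpha> i)) + (\<Sum>j\<in>J. b j * (\<Sum>i=1..k. \<rho> i * ?P j (\<alpha> i)))"
  proof -
    have "(\<Sum>i=1..k. \<rho> i * F (\<alpha> i)) =
        (\<Sum>i=1..k. \<rho> i * f (\<alpha> i) + (\<Sum>j\<in>J. b j * (\<rho> i * ?P j (\<alpha> i))))"
    proof (intro sum.cong refl)
      fix i assume "i \<in> {1..k}"
      then have "\<alpha> i \<in> {-1..1}" using rule by (force simp: quadrature_rule_def)
      then show "\<rho> i * F (\<alpha> i) = \<rho> i * f (\<alpha> i) + (\<Sum>j\<in>J. b j * (\<rho> i * ?P j (\<alpha> i)))"
        by (simp add: F_eq sum_distrib_left algebra_simps)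
    qed
    also have "\<dots> = (\<Sum>i=1..k. \<rho> i * f (\<alpha> i)) + (\<Sum>j\<in>J. \<Sum>i=1..k. b j * (\<rho> i * ?P j (\<alpha> i)))"
      by (simp add: sum.distrib sum.swap[of _ J])
    finally show ?thesis by (simp add: sum_distrib_left)
  qed
  moreover have "(\<Sum>j\<in>J. b j * Q_val n N k \<alpha> \<rho> j) =
      (\<Sum>j\<in>J. b j) / real N + (\<Sum>j\<in>J. b j * (\<Sum>i=1..k. \<rho> i * ?P j (\<alpha> i)))"
    by (simp add: Q_val_def distrib_left sum.distrib sum_divide_distrib)
  moreover have "(\<Sum>j\<in>J. b j * Q_val n N k \<alpha> \<rho> j) \<ge> 0"
    using b_nonneg Q J(2) by (intro sum_nonneg mult_nonneg_nonneg) auto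
  ultimately show ?thesis by (simp add: add_divide_distrib)
qed

theorem theorem2p6:
  fixes n N k :: nat
    and h :: "real \<Rightarrow> ereal"
    and \<alpha> \<rho> :: "nat \<Rightarrow> real"
    and \<Lambda> \<Lambda>' :: "(real \<Rightarrow> real) set"
    and I :: "nat set"
  assumes "n \<ge> 2" and "N \<ge> 2"
    and "\<And>t. t \<in> {-1..1} \<Longrightarrow> 0 \<le> h t"
    and "subspace \<Lambda>" and "\<Lambda> \<subseteq> C_interval"
    and "quadrature_rule k \<alpha> \<rho>"
    and "exact_for n N k \<alpha> \<rho> \<Lambda>"
    and "W_val n N \<Lambda> h = ereal ((real N)\<^sup>2) * (\<Sum>i=1..k. ereal (\<rho> i) * h (\<alpha> i))"
    and "I \<subseteq> {1..}"
    and "orthogonal_direct_sum n \<Lambda> (span (gegenbauer_fun n ` I)) \<Lambda>'"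
    and "\<And>j. j \<in> I \<Longrightarrow> Q_val n N k \<alpha> \<rho> j \<ge> 0"
  shows "W_val n N \<Lambda>' h = W_val n N \<Lambda> h \<and>
    W_val n N \<Lambda> h = ereal ((real N)\<^sup>2) * (\<Sum>i=1..k. ereal (\<rho> i) * h (\<alpha> i))"
proof -
  have "f \<in> \<Lambda>'" if "f \<in> \<Lambda>" for f
  proof -
    have "f = f + 0" by simp
    with that span_zero show ?thesis
      using assms(10) unfolding orthogonal_direct_sum_def by blast
  qed
  then have "W_val n N \<Lambda> h \<le> W_val n N \<Lambda>' h"
    unfolding W_val_def by (intro SUP_subset_mono) auto
  moreover have "W_val n N \<Lambda>' h \<le> ereal ((real N)\<^sup>2) * (\<Sum>i=1..k. ereal (\<rho> i) * h (\<alpha> i))"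
    unfolding W_val_def
  proof (rule SUP_least)
    fix F assume F: "F \<in> \<Lambda>' \<inter> A_set n h"
    have "ereal ((real N)\<^sup>2 * (zeroth_coeff n F - F 1 / real N))
        \<le> ereal ((real N)\<^sup>2 * (\<Sum>i=1..k. \<rho> i * F (\<alpha> i)))"
      using F admissible_value_le[OF assms(1,5-7,9-11), of F h] by (simp add: mult_left_mono)
    also have "\<dots> = ereal ((real N)\<^sup>2) * (\<Sum>i=1..k. ereal (\<rho> i) * ereal (F (\<alpha> i)))"
      by simp
    also have "\<dots> \<le> ereal ((real N)\<^sup>2) * (\<Sum>i=1..k. ereal (\<rho> i) * h (\<alpha> i))"
    proof (intro ereal_mult_left_mono sum_mono)
      fix i assume "i \<in> {1..k}"
      then have "\<alpha> i \<in> {-1..1}" "\<rho> i > 0"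
        using assms(6) by (force simp: quadrature_rule_def)+
      then show "ereal (F (\<alpha> i)) \<le> h (\<alpha> i)" "0 \<le> ereal (\<rho> i)"
        using F by (auto simp: A_set_def)
    qed simp
    finally show "ereal ((real N)\<^sup>2 * (zeroth_coeff n F - F 1 / real N))
        \<le> ereal ((real N)\<^sup>2) * (\<Sum>i=1..k. ereal (\<rho> i) * h (\<alpha> i))" .
  qed
  ultimately show ?thesis using assms(8) by auto
qed

end
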